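(* There is a (total) multi-valued function $F: [0,1]\Rightarrow\mathbb{R}$ such that $F(x)$ is a closed subset of $\mathbb{R}$ for every $x\in[0,1]$, the graph of $F$ is a $\Pi^0_2$ subset of $[0,1]\times\mathbb{R}$, and the set of points of continuity of $F$ is not a $\Pi^0_3$ subset of $[0,1]$.
   Context: A multi-valued function $F: X \Rightarrow Y$ assigns to each $x$ a nonempty subset $F(x)\subseteq Y$ and is identified with its graph $\{(x,y):y\in F(x)\}\subseteq X\times Y$. $F$ is continuous at $x$ if there is some $y\in F(x)$ such that for every $\varepsilon>0$ there is $\delta>0$ such that for every $x'$ with $|x-x'|<\delta$ there is $y'\in F(x')$ with $|y-y'|<\varepsilon$. $\Pi^0_2$ = $G_\delta$; $\Pi^0_3$ = countable intersections of $F_\sigma$ sets (usual Borel hierarchy), with the usual topologies on $[0,1]$ and $\mathbb{R}$. *)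

theory Defs
  imports "HOL-Analysis.Analysis"
begin

text \<open>A multi-valued function from \<open>X\<close> to \<open>Y\<close> is represented by \<open>F :: 'a \<Rightarrow> 'b set\<close>, of which only
  the values on \<open>X\<close> matter. Its graph is \<open>Sigma X F\<close>.\<close>

definition multifunction :: "'a set \<Rightarrow> 'b set \<Rightarrow> ('a \<Rightarrow> 'b set) \<Rightarrow> bool"
  where "multifunction X Y F \<longleftrightarrow> (\<forall>x\<in>X. F x \<noteq> {} \<and> F x \<subseteq> Y)"

text \<open>Only one value \<open>y \<in> F x\<close> has to be approximated by values at nearby points, and the nearby
  points \<open>x'\<close> range over the domain \<open>X\<close>.\<close>

definition mv_continuous_at ::
    "'a::metric_space set \<Rightarrow> ('a \<Rightarrow> 'b::metric_space set) \<Rightarrow> 'a \<Rightarrow> bool"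
  where "mv_continuous_at X F x \<longleftrightarrow>
    (\<exists>y\<in>F x. \<forall>\<epsilon>>0. \<exists>\<delta>>0. \<forall>x'\<in>X. dist x x' < \<delta> \<longrightarrow> (\<exists>y'\<in>F x'. dist y y' < \<epsilon>))"

text \<open>The class \<open>\<Pi>\<^sup>0\<^sub>3\<close> of a topological space, following the pattern of \<^const>\<open>gdelta_in\<close>:
  taking the intersection relative to the whole space makes the empty intersection equal to
  the space.\<close>

definition Pi03_in :: "'a topology \<Rightarrow> 'a set \<Rightarrow> bool"
  where "Pi03_in T \<equiv> (countable intersection_of fsigma_in T) relative_to topspace T"

end

theory Submission
  imports Defs
begin

text \<open>For open sets \<open>W n k\<close>, let \<open>F x\<close> contain the integer \<open>n\<close> iff \<open>x\<close> lies in every \<open>W n k\<close>, and let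
  the number of allowed approximations to \<open>n\<close> grow with the number of \<open>k\<close> for which \<open>x\<close> has been seen
  to lie in \<open>W n k\<close>. Then \<open>F\<close> is continuous exactly at the points of the arbitrary \<open>\<Sigma>\<^sup>0\<^sub>3\<close> set
  \<open>\<Union>n. \<Inter>k. W n k\<close>. A \<open>\<Sigma>\<^sup>0\<^sub>3\<close> set that is not \<open>\<Pi>\<^sup>0\<^sub>3\<close> is obtained by coding binary arrays as
  reals and asking for a row with infinitely many ones.\<close>

section \<open>Normal form of the sets in \<open>Pi03_in\<close> by double sequences\<close>

lemma Pi03_in_double_sequence:
  assumes "Pi03_in T S"
  obtains C :: "nat \<Rightarrow> nat \<Rightarrow> 'a set"
  where "\<And>m j. closedin T (C m j)" "S = (\<Inter>m. \<Union>j. C m j)"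
proof -
  obtain \<U> where \<U>: "countable \<U>" "\<And>U. U \<in> \<U> \<Longrightarrow> fsigma_in T U" "S = topspace T \<inter> \<Inter>\<U>"
    using assms unfolding Pi03_in_def relative_to_def intersection_of_def by auto
  \<comment> \<open>The whole space leaves the intersection unchanged and makes the family nonempty,
    hence the range of a sequence.\<close>
  define \<V> where "\<V> = insert (topspace T) \<U>"
  have "countable \<V>" "\<V> \<noteq> {}"
    using \<U>(1) by (auto simp: \<V>_def)
  then obtain V :: "nat \<Rightarrow> 'a set" where V: "\<V> = range V"
    using uncountable_def by metis
  have "fsigma_in T (V m)" for m
  proof -
    have "V m \<in> insert (topspace T) \<U>"
      using V \<V>_def by blast
    then show ?thesis
      using \<U>(2) by auto
  qed
  then have "\<exists>C. (\<forall>j. closedin T (C j)) \<and> (\<Union>j::nat. C j) = V m" for m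
    unfolding fsigma_in_ascending by meson
  then obtain C :: "nat \<Rightarrow> nat \<Rightarrow> 'a set"
    where C: "\<And>m j. closedin T (C m j)" "\<And>m. (\<Union>j. C m j) = V m"
    by metis
  have "S = \<Inter>\<V>"
    using \<U>(3) by (simp add: \<V>_def)
  then have "S = (\<Inter>m. \<Union>j. C m j)"
    using V C(2) by simp
  then show thesis
    using C(1) that by blast
qed

section \<open>A \<open>\<Pi>\<^sup>0\<^sub>3\<close> set of binary arrays that is not \<open>\<Sigma>\<^sup>0\<^sub>3\<close>\<close>

definition finite_rows :: "(nat \<Rightarrow> nat \<Rightarrow> bool) set"
  where "finite_rows = {a. \<forall>n. finite {k. a n k}}"

text \<open>A Baire category argument in the space of arrays of which every row is fixed completely before
  the next: were the \<open>G\<^sub>\<delta>\<close> set \<open>\<Inter>j. G j\<close> dense there, it would also be dense in the product topology,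
  and hence would contain an array whose row \<open>r\<close> has infinitely many ones.\<close>

lemma avoid_gdelta:
  fixes G :: "nat \<Rightarrow> (nat \<Rightarrow> nat \<Rightarrow> bool) set"
  assumes opn: "\<And>j a. a \<in> G j \<Longrightarrow> \<exists>N. \<forall>b. (\<forall>n<N. \<forall>k<N. b n k = a n k) \<longrightarrow> b \<in> G j"
    and sub: "(\<Inter>j. G j) \<subseteq> finite_rows"
    and a: "a \<in> finite_rows"
  shows "\<exists>b r'. b \<in> finite_rows \<and> (\<forall>n<r. b n = a n) \<and> r < r' \<and>
    (\<forall>c\<in>finite_rows. (\<forall>n<r'. c n = b n) \<longrightarrow> c \<notin> (\<Inter>j. G j))"
proof (rule ccontr)
  assume "\<not> ?thesis"
  then have dense: "\<exists>c\<in>finite_rows. (\<forall>n<r'. c n = b n) \<and> c \<in> (\<Inter>j. G j)"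
    if "b \<in> finite_rows" "\<forall>n<r. b n = a n" "r < r'" for b r'
    using that by blast
  define P where "P = (\<lambda>(j::nat) (b, N::nat). b \<in> finite_rows \<and> (\<forall>n<r. b n = a n) \<and> j \<le> N)"
  \<comment> \<open>The block of side \<open>N\<close> is frozen. The next block forces membership
    in \<open>G j\<close> and contains a one in row \<open>r\<close> at column \<open>N\<close>,
    outside the old block.\<close>
  define Q where "Q = (\<lambda>j (b, N) (b', N'). (\<forall>n<N. \<forall>k<N. b' n k = b n k) \<and> N < N' \<and>
      (\<forall>d. (\<forall>n<N'. \<forall>k<N'. d n k = b' n k) \<longrightarrow> d \<in> G j) \<and> b' r N \<and> r < N')"
  have "\<exists>f. \<forall>j. P j (f j) \<and> Q j (f j) (f (Suc j))"
  proof (rule dependent_nat_choice)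
    show "\<exists>x. P 0 x"
      using a by (auto simp: P_def)
  next
    fix x j
    assume "P j x"
    moreover obtain b N where x: "x = (b, N)"
      by force
    ultimately have b: "b \<in> finite_rows" "\<forall>n<r. b n = a n" "j \<le> N"
      by (auto simp: P_def)
    define b1 where "b1 = b(r := (b r)(N := True))"
    have "finite {k. b1 n k}" for n
    proof -
      have "{k. b1 n k} \<subseteq> insert N {k. b n k}"
        by (auto simp: b1_def split: if_splits)
      then show ?thesis
        using b(1) finite_subset by (fastforce simp: finite_rows_def)
    qed
    then have "b1 \<in> finite_rows"
      by (simp add: finite_rows_def)
    moreover have "\<forall>n<r. b1 n = a n" "r < Suc (max r N)"
      using b(2) by (simp_all add: b1_def)
    ultimately have "\<exists>c\<in>finite_rows. (\<forall>n<Suc (max r N). c n = b1 n) \<and> c \<in> (\<Inter>j. G j)"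
      by (rule dense)
    then obtain c where c: "c \<in> finite_rows" "\<forall>n<Suc (max r N). c n = b1 n" "c \<in> (\<Inter>j. G j)"
      by blast
    obtain M where M: "\<forall>d. (\<forall>n<M. \<forall>k<M. d n k = c n k) \<longrightarrow> d \<in> G j"
      using opn[of c j] c(3) by auto
    define N' where "N' = M + Suc (max r N)"
    have "\<forall>n<N. \<forall>k<N. c n k = b n k"
      using c(2) by (auto simp: b1_def)
    moreover have "c r N"
      using c(2) by (simp add: b1_def)
    moreover have "\<forall>n<r. c n = a n"
      using c(2) \<open>\<forall>n<r. b1 n = a n\<close> by simp
    moreover have "\<forall>d. (\<forall>n<N'. \<forall>k<N'. d n k = c n k) \<longrightarrow> d \<in> G j"
      using M by (simp add: N'_def)
    moreover have "N < N'" "r < N'"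
      by (simp_all add: N'_def)
    ultimately have "P (Suc j) (c, N') \<and> Q j x (c, N')"
      using c(1) b(3) by (auto simp: P_def Q_def x)
    then show "\<exists>y. P (Suc j) y \<and> Q j x y"
      by blast
  qed
  then obtain f where f: "\<And>j. P j (f j)" "\<And>j. Q j (f j) (f (Suc j))"
    by blast
  define b N where "b = fst \<circ> f" and "N = snd \<circ> f"
  have feq: "f j = (b j, N j)" for j
    by (simp add: b_def N_def)
  have step: "\<And>j n k. n < N j \<Longrightarrow> k < N j \<Longrightarrow> b (Suc j) n k = b j n k"
    and N: "\<And>j. N j < N (Suc j)"
    and inO: "\<And>j d. (\<forall>n<N (Suc j). \<forall>k<N (Suc j). d n k = b (Suc j) n k) \<Longrightarrow> d \<in> G j"
    and one: "\<And>j. b (Suc j) r (N j)" and rN: "\<And>j. r < N (Suc j)"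
    using f(2) unfolding Q_def feq by auto
  have jN: "j \<le> N j" for j
    using f(1)[of j] by (auto simp: P_def feq)
  have mono: "N i \<le> N j" if "i \<le> j" for i j
    using lift_Suc_mono_le[of N, OF less_imp_le] N that by blast
  have agree: "b j n k = b i n k" if "i \<le> j" "n < N i" "k < N i" for i j n k
    using \<open>i \<le> j\<close>
  proof (induction rule: dec_induct)
    case (step m)
    then show ?case
      using that mono[of i m] \<open>\<And>j n k. n < N j \<Longrightarrow> k < N j \<Longrightarrow> b (Suc j) n k = b j n k\<close> by simp
  qed simp
  \<comment> \<open>Since \<open>j <= N j\<close>, entry \<open>(n, k)\<close> is frozen from stage
    \<open>Suc (max n k)\<close> on.\<close>
  define d where "d n k = b (Suc (max n k)) n k" for n k
  have d: "d n k = b j n k" if "n < N j" "k < N j" for n k j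
  proof -
    have "n < N (Suc (max n k))" "k < N (Suc (max n k))"
      using jN[of "Suc (max n k)"] by simp_all
    then show ?thesis
      using agree[of j "Suc (max n k)" n k] agree[of "Suc (max n k)" j n k] that
      unfolding d_def by (metis nat_le_linear)
  qed
  have "d \<in> (\<Inter>j. G j)"
    using inO d by auto
  then have "finite {k. d r k}"
    using sub by (auto simp: finite_rows_def)
  moreover have "d r (N j)" for j
    using d[of r "Suc j" "N j"] one rN N by simp
  then have "range N \<subseteq> {k. d r k}"
    by blast
  moreover have "infinite (range N)"
    using N by (meson finite_imageD infinite_UNIV_nat strict_mono_Suc_iff strict_mono_imp_inj_on)
  ultimately show False
    using finite_subset by blast
qed

text \<open>Diagonalisation: stage \<open>m\<close> uses \<open>avoid_gdelta\<close> to freeze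
  finitely many complete rows so as to exclude the \<open>m\<close>-th intersection. Because whole
  rows are frozen, each row of the limit is a row of an array in \<open>finite_rows\<close>, so the
  limit stays in \<open>finite_rows\<close>.\<close>

lemma finite_rows_not_Union_gdelta:
  fixes G :: "nat \<Rightarrow> nat \<Rightarrow> (nat \<Rightarrow> nat \<Rightarrow> bool) set"
  assumes opn: "\<And>m j a. a \<in> G m j \<Longrightarrow> \<exists>N. \<forall>b. (\<forall>n<N. \<forall>k<N. b n k = a n k) \<longrightarrow> b \<in> G m j"
  shows "finite_rows \<noteq> (\<Union>m. \<Inter>j. G m j)"
proof
  assume eq: "finite_rows = (\<Union>m. \<Inter>j. G m j)"
  define P where "P = (\<lambda>(m::nat) (a, r::nat). a \<in> finite_rows \<and> m \<le> r)"
  define Q where "Q = (\<lambda>m (a, r) (b, r'). (\<forall>n<r. b n = a n) \<and> r < r' \<and>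
    (\<forall>c\<in>finite_rows. (\<forall>n<r'. c n = b n) \<longrightarrow> c \<notin> (\<Inter>j. G m j)))"
  have "\<exists>f. \<forall>m. P m (f m) \<and> Q m (f m) (f (Suc m))"
  proof (rule dependent_nat_choice)
    have "(\<lambda>n k. False) \<in> finite_rows"
      by (simp add: finite_rows_def)
    then show "\<exists>x. P 0 x"
      by (auto simp: P_def)
  next
    fix x m
    assume "P m x"
    moreover obtain a r where x: "x = (a, r)"
      by force
    ultimately have a: "a \<in> finite_rows" "m \<le> r"
      by (auto simp: P_def)
    have "(\<Inter>j. G m j) \<subseteq> finite_rows"
      using eq by blast
    from avoid_gdelta[OF opn this a(1), of r] obtain b r' where
      "b \<in> finite_rows" "\<forall>n<r. b n = a n" "r < r'"
      "\<forall>c\<in>finite_rows. (\<forall>n<r'. c n = b n) \<longrightarrow> c \<notin> (\<Inter>j. G m j)"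
      by blast
    then have "P (Suc m) (b, r') \<and> Q m x (b, r')"
      using a(2) by (auto simp: P_def Q_def x)
    then show "\<exists>y. P (Suc m) y \<and> Q m x y"
      by blast
  qed
  then obtain f where f: "\<And>m. P m (f m)" "\<And>m. Q m (f m) (f (Suc m))"
    by blast
  define a r where "a = fst \<circ> f" and "r = snd \<circ> f"
  have feq: "f m = (a m, r m)" for m
    by (simp add: a_def r_def)
  have fin: "a m \<in> finite_rows" and mr: "m \<le> r m" for m
    using f(1)[of m] by (auto simp: P_def feq)
  have same: "\<And>m n. n < r m \<Longrightarrow> a (Suc m) n = a m n"
    and r: "\<And>m. r m < r (Suc m)"
    and avoid: "\<And>m c. c \<in> finite_rows \<Longrightarrow> (\<forall>n<r (Suc m). c n = a (Suc m) n) \<Longrightarrow> c \<notin> (\<Inter>j. G m j)"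
    using f(2) unfolding Q_def feq by auto
  have mono: "r i \<le> r j" if "i \<le> j" for i j
    using lift_Suc_mono_le[of r, OF less_imp_le] r that by blast
  have agree: "a j n = a i n" if "i \<le> j" "n < r i" for i j n
    using \<open>i \<le> j\<close>
  proof (induction rule: dec_induct)
    case (step m)
    then show ?case
      using that mono[of i m] same by simp
  qed simp
  define c where "c n = a (Suc n) n" for n
  have c: "c n = a m n" if "n < r m" for m n
  proof -
    have "n < r (Suc n)"
      using mr[of "Suc n"] by simp
    then show ?thesis
      using agree[of m "Suc n" n] agree[of "Suc n" m n] that
      unfolding c_def by (metis nat_le_linear)
  qed
  have "c \<in> finite_rows"
    using fin by (simp add: finite_rows_def c_def)
  moreover from this obtain m where "c \<in> (\<Inter>j. G m j)"
    using eq by blast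
  moreover have "\<forall>n<r (Suc m). c n = a (Suc m) n"
    using c by blast
  ultimately show False
    using avoid by blast
qed

section \<open>Coding into the unit interval\<close>

text \<open>Base 4 with digits 0 and 1 keeps the codes of different sequences apart.\<close>

definition code :: "(nat \<Rightarrow> bool) \<Rightarrow> real"
  where "code a = (\<Sum>i. of_bool (a i) * (1/4) ^ Suc i)"

lemma summable_code: "summable (\<lambda>i. of_bool (a i) * (1/4 :: real) ^ Suc i)"
proof (rule summable_comparison_test')
  show "summable (\<lambda>i. (1/4 :: real) ^ Suc i)"
    by (subst summable_Suc_iff) (simp add: summable_geometric)
  show "norm (of_bool (a n) * (1/4 :: real) ^ Suc n) \<le> (1/4) ^ Suc n" if "n \<ge> 0" for n
    by simp
qed

lemma code_nonneg: "0 \<le> code a"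
  unfolding code_def by (intro suminf_nonneg summable_code) simp

lemma code_le: "code a \<le> 1/3"
proof -
  have s: "(\<lambda>i. (1/4 :: real) ^ Suc i) sums (1/4 * (1 / (1 - 1/4)))"
    unfolding power_Suc by (intro sums_mult geometric_sums) simp
  have "code a \<le> (\<Sum>i. (1/4 :: real) ^ Suc i)"
    unfolding code_def by (intro suminf_le summable_code sums_summable[OF s]) simp
  then show ?thesis
    using sums_unique[OF s] by simp
qed

lemma code_rec: "code a = (of_bool (a 0) + code (\<lambda>i. a (Suc i))) / 4"
proof -
  have "code a = of_bool (a 0) / 4 + (\<Sum>i. (1/4) * (of_bool (a (Suc i)) * (1/4) ^ Suc i))"
    unfolding code_def using suminf_split_head[OF summable_code[of a]] by (simp add: mult_ac)
  also have "(\<Sum>i. (1/4) * (of_bool (a (Suc i)) * (1/4 :: real) ^ Suc i)) = (1/4) * code (\<lambda>i. a (Suc i))"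
    unfolding code_def by (rule suminf_mult[OF summable_code])
  finally show ?thesis
    by (simp add: field_simps)
qed

lemma dist_code_le:
  assumes "\<And>i. i < n \<Longrightarrow> a i = b i"
  shows "dist (code a) (code b) \<le> (1/4) ^ n"
  using assms
proof (induction n arbitrary: a b)
  case 0
  then show ?case
    using code_nonneg[of a] code_le[of a] code_nonneg[of b] code_le[of b] by (simp add: dist_real_def)
next
  case (Suc n)
  have "dist (code (\<lambda>i. a (Suc i))) (code (\<lambda>i. b (Suc i))) \<le> (1/4) ^ n"
    by (rule Suc.IH) (simp add: Suc.prems)
  then show ?case
    using Suc.prems[of 0] by (simp add: code_rec[of a] code_rec[of b] dist_real_def flip: diff_divide_distrib)
qed

text \<open>Tails have codes in \<open>[0, 1/3]\<close>, so differing leading digits leave a gap of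
  at least 2/3 before the division by 4.\<close>

lemma dist_code_ge:
  assumes "a i \<noteq> b i"
  shows "dist (code a) (code b) \<ge> (1/4) ^ Suc i / 2"
  using assms
proof (induction i arbitrary: a b)
  case 0
  define a' b' where "a' = code (\<lambda>i. a (Suc i))" and "b' = code (\<lambda>i. b (Suc i))"
  have bounds: "0 \<le> a'" "a' \<le> 1/3" "0 \<le> b'" "b' \<le> 1/3"
    unfolding a'_def b'_def by (rule code_nonneg code_le)+
  have "\<bar>(of_bool (a 0) + a') - (of_bool (b 0) + b')\<bar> \<ge> 1/2"
    using bounds 0 by (cases "a 0"; cases "b 0") auto
  then show ?case
    by (simp add: code_rec[of a] code_rec[of b] dist_real_def a'_def b'_def flip: diff_divide_distrib)
next
  case (Suc i)
  define a' b' where "a' = code (\<lambda>i. a (Suc i))" and "b' = code (\<lambda>i. b (Suc i))"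
  have IH: "\<bar>a' - b'\<bar> \<ge> (1/4) ^ Suc i / 2"
    using Suc.IH[of "\<lambda>i. a (Suc i)" "\<lambda>i. b (Suc i)"] Suc.prems by (simp add: a'_def b'_def dist_real_def)
  have bounds: "0 \<le> a'" "a' \<le> 1/3" "0 \<le> b'" "b' \<le> 1/3"
    unfolding a'_def b'_def by (rule code_nonneg code_le)+
  \<comment> \<open>The leading digits may differ too; the resulting gap of at least 2/3 exceeds any
    difference of tails, which is at most 1/3.\<close>
  have "\<bar>(of_bool (a 0) + a') - (of_bool (b 0) + b')\<bar> \<ge> \<bar>a' - b'\<bar>"
    using bounds by (cases "a 0"; cases "b 0") auto
  with IH have "\<bar>(of_bool (a 0) + a') - (of_bool (b 0) + b')\<bar> \<ge> (1/4) ^ Suc i / 2"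
    by linarith
  then show ?case
    by (simp add: code_rec[of a] code_rec[of b] dist_real_def a'_def b'_def flip: diff_divide_distrib)
qed

section \<open>Coding of binary arrays\<close>

definition code2 :: "(nat \<Rightarrow> nat \<Rightarrow> bool) \<Rightarrow> real"
  where "code2 a = code (\<lambda>i. case_prod a (prod_decode i))"

lemma code2_in_unit: "code2 a \<in> {0..1}"
  using code_nonneg code_le[of "\<lambda>i. case_prod a (prod_decode i)"] by (auto simp: code2_def)

lemma code2_continuous:
  assumes "0 < e"
  shows "\<exists>N. \<forall>b. (\<forall>n<N. \<forall>k<N. b n k = a n k) \<longrightarrow> dist (code2 b) (code2 a) < e"
proof -
  obtain N where N: "(1/4 :: real) ^ N < e"
    using real_arch_pow_inv[OF assms, of "1/4"] by auto
  have "dist (code2 b) (code2 a) < e" if "\<forall>n<N. \<forall>k<N. b n k = a n k" for b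
  proof -
    \<comment> \<open>\<open>prod_encode\<close> dominates both coordinates, so the first
      \<open>N\<close> digits come from the block of side \<open>N\<close>.\<close>
    have "case_prod b (prod_decode i) = case_prod a (prod_decode i)" if "i < N" for i
    proof -
      obtain n k where nk: "prod_decode i = (n, k)"
        by force
      then have "i = prod_encode (n, k)"
        by (metis prod_decode_inverse)
      then have "n < N" "k < N"
        using \<open>i < N\<close> le_prod_encode_1[of n k] le_prod_encode_2[of k n] by auto
      then show ?thesis
        using \<open>\<forall>n<N. \<forall>k<N. b n k = a n k\<close> by (simp add: nk)
    qed
    from dist_code_le[of N, OF this] N show ?thesis
      unfolding code2_def by fastforce
  qed
  then show ?thesis
    by blast
qed

text \<open>Balls around the codes with digit one, of the radius from \<open>dist_code_ge\<close>,
  miss every code with digit zero. Only the trace on the range of \<open>code2\<close>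
  matters.\<close>

lemma code2_digit_open:
  obtains V :: "nat \<Rightarrow> nat \<Rightarrow> real set"
  where "\<And>n k. open (V n k)" "\<And>a n k. code2 a \<in> V n k \<longleftrightarrow> a n k"
proof
  define R where "R n k = (1/4 :: real) ^ Suc (prod_encode (n, k)) / 2" for n k
  define V where "V n k = (\<Union>a\<in>{a. a n k}. ball (code2 a) (R n k))" for n k
  show "open (V n k)" for n k
    by (auto simp: V_def)
  show "code2 a \<in> V n k \<longleftrightarrow> a n k" for a n k
  proof
    assume "code2 a \<in> V n k"
    then obtain b where b: "b n k" "dist (code2 b) (code2 a) < R n k"
      by (auto simp: V_def)
    then show "a n k"
      using dist_code_ge[of "\<lambda>i. case_prod b (prod_decode i)" "prod_encode (n, k)"
          "\<lambda>i. case_prod a (prod_decode i)"]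
      by (auto simp: code2_def R_def)
  next
    assume "a n k"
    moreover have "0 < R n k"
      by (simp add: R_def)
    ultimately show "code2 a \<in> V n k"
      by (auto simp: V_def)
  qed
qed

section \<open>Transfer from arrays to the unit interval\<close>

lemma Sigma03_not_Pi03_in_unit:
  obtains W :: "nat \<Rightarrow> nat \<Rightarrow> real set"
  where "\<And>n k. open (W n k)"
    "\<not> Pi03_in (top_of_set {0..1}) ({0..1} \<inter> (\<Union>n. \<Inter>k. W n k))"
proof -
  obtain V :: "nat \<Rightarrow> nat \<Rightarrow> real set"
    where V: "\<And>n k. open (V n k)" "\<And>a n k. code2 a \<in> V n k \<longleftrightarrow> a n k"
    using code2_digit_open by blast
  \<comment> \<open>A one at column \<open>j\<close> or later; for all \<open>j\<close> together,
    this says that row \<open>n\<close> has infinitely many ones.\<close>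
  define W where "W n j = (\<Union>k\<in>{j..}. V n k)" for n j
  define S where "S = {0..1} \<inter> (\<Union>n. \<Inter>k. W n k)"
  have in_S: "code2 a \<in> S \<longleftrightarrow> a \<notin> finite_rows" for a
    using code2_in_unit[of a]
    by (auto simp: S_def W_def V(2) finite_rows_def infinite_nat_iff_unbounded_le Bex_def)
  have "\<not> Pi03_in (top_of_set {0..1}) S"
  proof
    assume "Pi03_in (top_of_set {0..1}) S"
    then obtain C :: "nat \<Rightarrow> nat \<Rightarrow> real set"
      where C: "\<And>m j. closedin (top_of_set {0..1}) (C m j)" "S = (\<Inter>m. \<Union>j. C m j)"
      by (rule Pi03_in_double_sequence) blast
    have "\<exists>N. \<forall>b. (\<forall>n<N. \<forall>k<N. b n k = a n k) \<longrightarrow> b \<in> - (code2 -` C m j)"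
      if "a \<in> - (code2 -` C m j)" for m j a
    proof -
      have "closed (C m j)"
        using C(1) closedin_closed_trans closed_atLeastAtMost by blast
      moreover have "code2 a \<in> - C m j"
        using that by simp
      ultimately obtain e where e: "0 < e" "\<And>y. dist y (code2 a) < e \<Longrightarrow> y \<in> - C m j"
        by (metis open_dist open_Compl)
      from code2_continuous[OF e(1), of a] show ?thesis
        using e(2) by (metis ComplD ComplI vimage_eq)
    qed
    \<comment> \<open>Pulling the complement of \<open>S\<close> back along \<open>code2\<close>
      would write \<open>finite_rows\<close> as a countable union of \<open>G_delta\<close>
      sets.\<close>
    then have "finite_rows \<noteq> (\<Union>m. \<Inter>j. - (code2 -` C m j))"
      by (rule finite_rows_not_Union_gdelta)
    moreover have "a \<in> finite_rows \<longleftrightarrow> a \<in> (\<Union>m. \<Inter>j. - (code2 -` C m j))" for a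
      using in_S[of a] C(2) by auto
    ultimately show False
      by blast
  qed
  moreover have "open (W n j)" for n j
    using V(1) by (auto simp: W_def)
  ultimately show thesis
    using that[of W] unfolding S_def by blast
qed

section \<open>Realising \<open>\<Sigma>\<^sup>0\<^sub>3\<close> sets as sets of continuity points\<close>

lemma disjoint_countable_dense_reals:
  obtains D E :: "real set"
  where "countable D" "countable E" "D \<inter> E = {}"
    "\<And>u v. u < v \<Longrightarrow> \<exists>x\<in>D. u < x \<and> x < v" "\<And>u v. u < v \<Longrightarrow> \<exists>x\<in>E. u < x \<and> x < v"
proof -
  obtain t :: real where t: "t \<notin> \<rat>"
    using countable_rat uncountable_UNIV_real by (metis UNIV_I countable_subset subsetI)
  show thesis
  proof
    show "countable (\<rat> :: real set)" "countable ((+) t ` \<rat>)"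
      using countable_rat by auto
    show "\<rat> \<inter> (+) t ` \<rat> = {}"
    proof -
      have "t + q \<notin> \<rat>" if "q \<in> \<rat>" for q
        using t that Rats_diff[of "t + q" q] by auto
      then show ?thesis
        by auto
    qed
    show "\<exists>x\<in>\<rat>. u < x \<and> x < v" if "u < v" for u v :: real
      using Rats_dense_in_real[OF that] by blast
    show "\<exists>x\<in>(+) t ` \<rat>. u < x \<and> x < v" if uv: "u < v" for u v
      using Rats_dense_in_real[of "u - t" "v - t"] uv by force
  qed
qed

lemma gdelta_in_implication:
  assumes "open J" "open E"
  shows "gdelta_in euclidean {(x :: real, y :: real). y \<in> J \<longrightarrow> x \<in> E}"
proof -
  have "{(x, y). y \<in> J \<longrightarrow> x \<in> E} = (UNIV \<times> (- J)) \<union> (E \<times> UNIV)"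
    by auto
  moreover have "gdelta_in euclidean (UNIV \<times> (- J) :: (real \<times> real) set)"
    using assms(1) closed_imp_gdelta_in[OF metrizable_space_euclidean]
    by (metis closed_Compl closed_Times closed_UNIV closed_closedin)
  moreover have "gdelta_in euclidean (E \<times> UNIV :: (real \<times> real) set)"
    using assms(2) by (intro open_imp_gdelta_in) (simp add: open_Times flip: open_openin)
  ultimately show ?thesis
    by (simp add: gdelta_in_Un)
qed

text \<open>A pair \<open>(J, E)\<close> forbids values in \<open>J\<close> at points outside
  \<open>E\<close>. Openness of \<open>J\<close> makes the values closed; each constraint on the
  graph is a closed set united with an open one, and there are countably many.\<close>

lemma constraint_multifunction_gdelta:
  fixes \<C> :: "(real set \<times> real set) set" and X :: "real set"
  assumes "countable \<C>" "\<And>J E. (J, E) \<in> \<C> \<Longrightarrow> open J \<and> open E"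
  defines "F \<equiv> \<lambda>x. {y. \<forall>(J, E)\<in>\<C>. y \<in> J \<longrightarrow> x \<in> E}"
  shows "closed (F x)" "gdelta_in (top_of_set (X \<times> UNIV)) (Sigma X F)"
proof -
  have "F x = (\<Inter>(J, E)\<in>\<C>. if x \<in> E then UNIV else - J)"
    by (auto simp: F_def split: if_splits)
  moreover have "closed (if x \<in> E then UNIV else - J)" if "(J, E) \<in> \<C>" for J E
    using assms(2)[OF that] by auto
  ultimately show "closed (F x)"
    by (auto intro!: closed_INT)
  define \<G> where "\<G> = insert UNIV ((\<lambda>(J, E). {(x, y). y \<in> J \<longrightarrow> x \<in> E}) ` \<C>)"
  have "gdelta_in euclidean (\<Inter>\<G>)"
  proof (rule gdelta_in_Inter)
    show "countable \<G>" "\<G> \<noteq> {}"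
      using assms(1) by (auto simp: \<G>_def)
    show "gdelta_in euclidean G" if "G \<in> \<G>" for G
    proof (cases "G = UNIV")
      case True
      then show ?thesis
        using gdelta_in_topspace[of euclidean] by simp
    next
      case False
      then have "G \<in> (\<lambda>(J, E). {(x, y). y \<in> J \<longrightarrow> x \<in> E}) ` \<C>"
        using that by (simp add: \<G>_def)
      then obtain J E where "(J, E) \<in> \<C>" "G = {(x, y). y \<in> J \<longrightarrow> x \<in> E}"
        by (elim imageE) (simp split: prod.splits)
      then show ?thesis
        using assms(2) gdelta_in_implication by metis
    qed
  qed
  moreover have "Sigma X F = \<Inter>\<G> \<inter> X \<times> UNIV"
    by (auto simp: F_def \<G>_def)
  ultimately show "gdelta_in (top_of_set (X \<times> UNIV)) (Sigma X F)"
    unfolding gdelta_in_subtopology by blast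
qed

text \<open>These overlapping intervals cover \<open>(0, 1)\<close>, so every noninteger value will
  fall under a density constraint.\<close>

lemma reciprocal_bracket:
  fixes t :: real
  assumes "0 < t" "t < 1"
  obtains i :: nat where "1 / (real i + 3) < t" "t < 1 / (real i + 1)"
proof
  \<comment> \<open>This choice gives \<open>i + 1 < 1 / t <= i + 2\<close>.\<close>
  define i where "i = nat (\<lceil>1 / t\<rceil> - 2)"
  have "1 / t > 1"
    using assms by simp
  then have "\<lceil>1 / t\<rceil> \<ge> 2"
    by linarith
  then have "real i = of_int \<lceil>1 / t\<rceil> - 2"
    by (simp add: i_def)
  then have "real i + 1 < 1 / t" "1 / t < real i + 3"
    by linarith+
  then show "1 / (real i + 3) < t" "t < 1 / (real i + 1)"
    using assms by (auto simp: field_simps)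
qed

text \<open>Integer values \<open>n\<close> of the multifunction are surrounded by approximations \<open>n + 1 / (i + 2)\<close>,
  which are only allowed at points outside a countable dense set depending on the parity of \<open>i\<close>. Hence no
  noninteger value can witness continuity, but as every point is outside one of the two dense sets,
  two consecutive approximations together cover all points.\<close>

lemma Sigma03_continuity_set:
  fixes W :: "nat \<Rightarrow> nat \<Rightarrow> real set"
  assumes W: "\<And>n k. open (W n k)"
  obtains F :: "real \<Rightarrow> real set"
  where "multifunction {0..1} UNIV F" "\<And>x. closed (F x)"
    "gdelta_in (top_of_set ({0..1} \<times> UNIV)) (Sigma {0..1} F)"
    "{x \<in> {0..1}. mv_continuous_at {0..1} F x} = {0..1} \<inter> (\<Union>n. \<Inter>k. W n k)"
proof -
  obtain D E :: "real set"
    where DE: "countable D" "countable E" "D \<inter> E = {}"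
      "\<And>u v. u < v \<Longrightarrow> \<exists>x\<in>D. u < x \<and> x < v" "\<And>u v. u < v \<Longrightarrow> \<exists>x\<in>E. u < x \<and> x < v"
    using disjoint_countable_dense_reals by blast
  define Q where "Q i = (if even i then D else E)" for i :: nat
  have Q: "countable (Q i)" "x \<notin> Q i \<or> x \<notin> Q (Suc i)" "u < v \<Longrightarrow> \<exists>x\<in>Q i. u < x \<and> x < v" for i x u v
    using DE(1,2,3) DE(4,5)[of u v] by (auto simp: Q_def)
  define val where "val n i = real n + 1 / (real i + 2)" for n i :: nat
  \<comment> \<open>A window around \<open>val n i\<close> that contains no other approximation: its
    ends are the neighbouring ones, or \<open>n + 1\<close> on the right for
    \<open>i = 0\<close>.\<close>
  define I where "I n i = {real n + 1 / (real i + 3)<..<real n + 1 / (real i + 1)}" for n i :: nat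
  \<comment> \<open>Contains \<open>n\<close> and exactly those \<open>val n j\<close> with
    \<open>j > k + 1\<close>. So \<open>n\<close> is subject to all \<open>W n k\<close>, but each
    approximation only to finitely many. The left end excludes the approximations to
    \<open>n - 1\<close>, which are at most \<open>n - 1/2\<close>.\<close>
  define J where "J n k = {real n - 1 / 2<..<real n + 1 / (real k + 3)}" for n k :: nat
  \<comment> \<open>The first pair rules out negative values. Excluding the points of
    \<open>Q i\<close> one at a time keeps each second component open.\<close>
  define \<C> where "\<C> = insert ({..<0}, {})
    ((\<Union>n. \<Union>i. \<Union>q\<in>Q i. {(I n i, - {q})}) \<union> (\<Union>n. \<Union>k. {(J n k, W n k)}))"
  define F where "F x = {y. \<forall>(J, E)\<in>\<C>. y \<in> J \<longrightarrow> x \<in> E}" for x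
  have F_iff: "y \<in> F x \<longleftrightarrow> 0 \<le> y \<and> (\<forall>n i. y \<in> I n i \<longrightarrow> x \<notin> Q i) \<and> (\<forall>n k. y \<in> J n k \<longrightarrow> x \<in> W n k)" for x y
  proof -
    have "(\<forall>q\<in>Q i. y \<in> I n i \<longrightarrow> x \<noteq> q) \<longleftrightarrow> (y \<in> I n i \<longrightarrow> x \<notin> Q i)" for n i
      by blast
    then show ?thesis
      by (simp add: F_def \<C>_def ball_Un not_less)
  qed
  have "countable \<C>"
    using Q(1) by (auto simp: \<C>_def)
  moreover have "open J \<and> open E" if "(J, E) \<in> \<C>" for J E
    using that W by (auto simp: \<C>_def I_def J_def)
  ultimately have clo: "\<And>x. closed (F x)"
    and gdelta: "gdelta_in (top_of_set ({0..1} \<times> UNIV)) (Sigma {0..1} F)"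
    using constraint_multifunction_gdelta[of \<C>] unfolding F_def by simp_all

  have frac1: "0 < 1 / (real i + 2)" "1 / (real i + 2) \<le> 1/2" for i
    by (auto simp: field_simps)
  have frac2: "0 < 1 / (real i + 3)" "1 / (real i + 3) \<le> 1/3" for i
    by (auto simp: field_simps)
  have frac3: "0 < 1 / (real i + 1)" "1 / (real i + 1) \<le> 1" for i
    by (auto simp: field_simps)
  have trich: "m = n \<or> real m + 1 \<le> real n \<or> real n + 1 \<le> real m" for m n :: nat
    by linarith
  have val_I: "m = n \<and> j = i" if "val m j \<in> I n i" for m j n i
  proof -
    have v: "real n + 1 / (real i + 3) < real m + 1 / (real j + 2)"
      "real m + 1 / (real j + 2) < real n + 1 / (real i + 1)"
      using that by (simp_all add: val_def I_def)
    have "\<not> real m + 1 \<le> real n" "\<not> real n + 1 \<le> real m"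
      using v frac1[of j] frac2[of i] frac3[of i] by linarith+
    then have "m = n"
      using trich by blast
    with v have "1 / (real i + 3) < 1 / (real j + 2)" "1 / (real j + 2) < 1 / (real i + 1)"
      by simp_all
    then have "real j + 2 < real i + 3" "real i + 1 < real j + 2"
      by (auto simp: field_simps)
    with \<open>m = n\<close> show ?thesis
      by linarith
  qed
  have val_J: "m = n \<and> Suc k < j" if "val m j \<in> J n k" for m j n k
  proof -
    have v: "real n - 1 / 2 < real m + 1 / (real j + 2)"
      "real m + 1 / (real j + 2) < real n + 1 / (real k + 3)"
      using that by (simp_all add: val_def J_def)
    have "\<not> real m + 1 \<le> real n" "\<not> real n + 1 \<le> real m"
      using v frac1[of j] frac2[of k] by linarith+
    then have "m = n"
      using trich by blast
    with v have "1 / (real j + 2) < 1 / (real k + 3)"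
      by simp
    then have "real k + 3 < real j + 2"
      by (auto simp: field_simps)
    with \<open>m = n\<close> show ?thesis
      by linarith
  qed
  have nat_I: "real m \<notin> I n i" for m n i
  proof
    assume "real m \<in> I n i"
    then have "real n + 1 / (real i + 3) < real m" "real m < real n + 1 / (real i + 1)"
      by (simp_all add: I_def)
    then show False
      using trich[of m n] frac2[of i] frac3[of i] by linarith
  qed
  have nat_J: "real m \<in> J n k \<longleftrightarrow> m = n" for m n k
  proof -
    have "real m \<in> J n k \<longleftrightarrow> real n - 1 / 2 < real m \<and> real m < real n + 1 / (real k + 3)"
      by (simp add: J_def)
    then show ?thesis
      using trich[of m n] frac2[of k] by linarith
  qed
  have val_nonneg: "0 \<le> val n i" for n i
    by (simp add: val_def)
  have val_in: "val n i \<in> F x" if "x \<notin> Q i" "\<And>k. Suc k < i \<Longrightarrow> x \<in> W n k" for n i x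
    using that val_nonneg by (auto simp: F_iff dest!: val_I val_J)
  have nat_in: "real n \<in> F x \<longleftrightarrow> x \<in> (\<Inter>k. W n k)" for n x
    by (auto simp: F_iff nat_I nat_J)

  have cont: "mv_continuous_at {0..1} F x" if x: "x \<in> (\<Inter>k. W n k)" for n x
    unfolding mv_continuous_at_def
  proof (intro bexI[of _ "real n"] allI impI)
    show "real n \<in> F x"
      using x by (simp only: nat_in)
  next
    fix e :: real
    assume "0 < e"
    then obtain i where i: "1 / real (Suc i) < e"
      using nat_approx_posE by blast
    \<comment> \<open>The approximations with index at most \<open>Suc i\<close> are constrained
      only by \<open>W n k\<close> with \<open>k < i\<close>, so a whole neighbourhood of
      \<open>x\<close> satisfies these conditions.\<close>
    have "open (\<Inter>k\<in>{..<i}. W n k)"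
      using W by (intro open_INT) auto
    moreover have "x \<in> (\<Inter>k\<in>{..<i}. W n k)"
      using x by blast
    ultimately obtain d where d: "0 < d" "ball x d \<subseteq> (\<Inter>k\<in>{..<i}. W n k)"
      by (meson openE)
    have "\<exists>y'\<in>F x'. dist (real n) y' < e" if x': "dist x x' < d" for x'
    proof -
      obtain j where j: "j = i \<or> j = Suc i" "x' \<notin> Q j"
        using Q(2)[of x' i] by blast
      have "x' \<in> W n k" if "Suc k < j" for k
        using d(2) x' that j(1) by fastforce
      then have "val n j \<in> F x'"
        using j(2) val_in by blast
      moreover have "1 / (real j + 2) \<le> 1 / real (Suc i)"
        using j(1) by (intro divide_left_mono) auto
      then have "dist (real n) (val n j) < e"
        using i by (simp add: val_def dist_real_def)
      ultimately show ?thesis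
        by blast
    qed
    then show "\<exists>d>0. \<forall>x'\<in>{0..1}. dist x x' < d \<longrightarrow> (\<exists>y'\<in>F x'. dist (real n) y' < e)"
      using d(1) by blast
  qed

  have disc: "\<exists>n. x \<in> (\<Inter>k. W n k)" if x: "x \<in> {0..1}" "mv_continuous_at {0..1} F x" for x
  proof -
    obtain y where y: "y \<in> F x"
      "\<And>e. 0 < e \<Longrightarrow> \<exists>d>0. \<forall>x'\<in>{0..1}. dist x x' < d \<longrightarrow> (\<exists>y'\<in>F x'. dist y y' < e)"
      using x(2) unfolding mv_continuous_at_def by blast
    define n where "n = nat \<lfloor>y\<rfloor>"
    have "0 \<le> y"
      using y(1) by (simp add: F_iff)
    then have n: "real n \<le> y" "y < real n + 1"
      by (auto simp: n_def)
    \<comment> \<open>Otherwise a ball around \<open>y\<close> lies in some \<open>I n i\<close>,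
      where no value is allowed at the points of \<open>Q i\<close>, which come arbitrarily close to
      \<open>x\<close>.\<close>
    have "y = real n"
    proof (rule ccontr)
      assume "y \<noteq> real n"
      then obtain i :: nat where "1 / (real i + 3) < y - real n" "y - real n < 1 / (real i + 1)"
        using reciprocal_bracket[of "y - real n"] n by auto
      then have "y \<in> I n i"
        by (auto simp: I_def)
      moreover have "open (I n i)"
        by (simp add: I_def)
      ultimately obtain e where e: "0 < e" "ball y e \<subseteq> I n i"
        by (meson openE)
      obtain d where d: "0 < d" "\<forall>x'\<in>{0..1}. dist x x' < d \<longrightarrow> (\<exists>y'\<in>F x'. dist y y' < e)"
        using y(2)[OF e(1)] by blast
      \<comment> \<open>The truncation keeps the dense point in the domain even when
        \<open>x\<close> is an end point.\<close>
      have "max 0 (x - d) < min 1 (x + d)"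
        using x(1) d(1) by auto
      then obtain x' where x': "x' \<in> Q i" "max 0 (x - d) < x'" "x' < min 1 (x + d)"
        using Q(3) by blast
      then have "x' \<in> {0..1}" "dist x x' < d"
        by (auto simp: dist_real_def)
      then obtain y' where "y' \<in> F x'" "dist y y' < e"
        using d(2) by blast
      then have "y' \<in> F x'" "y' \<in> I n i"
        using e(2) by auto
      then show False
        using x'(1) by (auto simp: F_iff)
    qed
    then show ?thesis
      using y(1) nat_in by blast
  qed

  \<comment> \<open>\<open>val 0 0\<close> and \<open>val 0 1\<close> carry no \<open>W\<close>
    condition, and one of them is allowed at \<open>x\<close>.\<close>
  have "F x \<noteq> {}" for x
    using Q(2)[of x 0] val_in[of x 0 0] val_in[of x 1 0] by auto
  then have "multifunction {0..1} UNIV F"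
    by (simp add: multifunction_def)
  moreover have "{x \<in> {0..1}. mv_continuous_at {0..1} F x} = {0..1} \<inter> (\<Union>n. \<Inter>k. W n k)"
    using cont disc by blast
  ultimately show thesis
    using clo gdelta that by blast
qed

theorem theorem2p6:
  shows "\<exists>F :: real \<Rightarrow> real set.
    multifunction {0..1} UNIV F \<and>
    (\<forall>x\<in>{0..1}. closed (F x)) \<and>
    gdelta_in (top_of_set ({0..1} \<times> UNIV)) (Sigma {0..1} F) \<and>
    \<not> Pi03_in (top_of_set {0..1}) {x \<in> {0..1}. mv_continuous_at {0..1} F x}"
proof -
  obtain W :: "nat \<Rightarrow> nat \<Rightarrow> real set"
    where W: "\<And>n k. open (W n k)"
      "\<not> Pi03_in (top_of_set {0..1}) ({0..1} \<inter> (\<Union>n. \<Inter>k. W n k))"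
    using Sigma03_not_Pi03_in_unit by blast
  obtain F :: "real \<Rightarrow> real set"
    where F: "multifunction {0..1} UNIV F" "\<And>x. closed (F x)"
      "gdelta_in (top_of_set ({0..1} \<times> UNIV)) (Sigma {0..1} F)"
      "{x \<in> {0..1}. mv_continuous_at {0..1} F x} = {0..1} \<inter> (\<Union>n. \<Inter>k. W n k)"
    using Sigma03_continuity_set[of W] W(1) by blast
  have "\<not> Pi03_in (top_of_set {0..1}) {x \<in> {0..1}. mv_continuous_at {0..1} F x}"
    using F(4) W(2) by metis
  then show ?thesis
    using F(1-3) by blast
qed

end
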